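(* Let $N\ge1$, let $\bm x=(x_1,\dots,x_N)$ with $0<x_1\le\dots\le x_N$, let $\bm w=(w_1,\dots,w_N)$ with $w_i>0$ for all $i$, and let $\theta\ge0$ and $\lambda,\nu\in\mathbb R$. Let $Q\in\mathbb R^{N\times N}$ be an admissible matrix (with respect to $\bm x$, $\bm w$) and let $\bm v_0=\mu\,\mathrm{diag}(\bm x)^{-1}\bm 1$ for some $\mu\ge0$. Then, for all $\bm v\in Q^{-1}\mathbb R_+^N$ and $h\ge 0$, the weak simulation algorithm $A^{\mathrm{CIR}}$ (described in the context) satisfies $A^{\mathrm{CIR}}(\bm v,h)\in Q^{-1}\mathbb R_+^N$ almost surely. In particular, $A^{\mathrm{CIR}}$ is well-defined, i.e. the square roots occurring in its definition are always taken of nonnegative numbers.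
   Context: Notation: $\bm e_i\in\mathbb R^N$ is the $i$-th unit (column) vector, $\bm 1=(1,\dots,1)^\top\in\mathbb R^N$, $\overline w=\bm w^\top\bm 1=\sum_{i=1}^N w_i$, $\mathrm{diag}(\bm x)$ is the diagonal matrix with diagonal entries $x_1,\dots,x_N$, $\mathbb R_+=[0,\infty)$, and $Q^{-1}\mathbb R_+^N=\{Q^{-1}\bm z:\bm z\in\mathbb R_+^N\}$. Definition (admissible matrix). A matrix $Q\in\mathbb R^{N\times N}$ is called admissible (with respect to $\bm x$, $\bm w$) if: (1) $Q$ is invertible; (2) $\bm e_N^\top Q=\bm w^\top$; (3) $Q\bm 1=\overline w\,\bm e_N$; (4) $(Q\,\mathrm{diag}(\bm x)Q^{-1})_{i,j}\le 0$ for all $i,j\in\{1,\dots,N\}$ with $i\ne j$. The algorithm $A^{\mathrm{CIR}}$ is a one-step approximation scheme for the SDE $d\bm V_t=-\mathrm{diag}(\bm x)(\bm V_t-\bm v_0)\,dt+(\theta-\lambda\bm w^\top\bm V_t)\bm 1\,dt+\nu\sqrt{\bm w^\top\bm V_t}\,\bm 1\,dW_t$. It is built from two maps. (i) Drift step. For $\bm z\in\mathbb R^N$ and $h\ge0$, $D(\bm z,h)$ is the solution at time $h$ of the linear ODE $$d\bm Z_t=-\mathrm{diag}(\bm x)(\bm Z_t-\bm v_0)\,dt+(\theta-\lambda\bm w^\top\bm Z_t)\bm 1\,dt,\qquad \bm Z_0=\bm z.$$ (ii) Diffusion step. For $\bm y\in\mathbb R^N$ and $h\ge 0$, put $x=\bm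 w^\top\bm y$, $z=\nu^2\overline w^2h$, $a=\frac{3+\sqrt3}{4}$, $$m_1=x,\quad m_2=x^2+xz,\quad m_3=x^3+3x^2z+\tfrac32xz^2,$$ $$\xi_1=x+(a+\tfrac34)z-\sqrt{\left(3x+(a+\tfrac34)^2z\right)z},\quad \xi_2=x+az,\quad \xi_3=x+(a+\tfrac34)z+\sqrt{\left(3x+(a+\tfrac34)^2z\right)z},$$ $$p_1=\frac{m_1\xi_2\xi_3-m_2(\xi_2+\xi_3)+m_3}{\xi_1(\xi_3-\xi_1)(\xi_2-\xi_1)},\quad p_2=\frac{m_1\xi_1\xi_3-m_2(\xi_1+\xi_3)+m_3}{\xi_2(\xi_3-\xi_2)(\xi_1-\xi_2)},\quad p_3=\frac{m_1\xi_1\xi_2-m_2(\xi_1+\xi_2)+m_3}{\xi_3(\xi_1-\xi_3)(\xi_2-\xi_3)}.$$ Let $\widehat Y_h$ be a random variable equal to $\xi_i$ with probability $p_i$, $i=1,2,3$ (for $x\ge0$ the $\xi_i$ are nonnegative and, when $x,z>0$, the $p_i$ are nonnegative and sum to $1$, as established by Lileika and Mackevičius); in the degenerate cases $x=0$ or $z=0$, where the quotients are not all defined, $\widehat Y_h=x$. Set $$\widehat S(\bm y,h)=\bm y+\frac{\widehat Y_h-\bm w^\top\bm y}{\overline w}\,\bm 1.$$ The algorithm is the Strang splitting $$A^{\mathrm{CIR}}(\bm v,h)=D\left(\widehat S\left(D\left(\bm v,\tfrac h2\right),h\right),\tfrac h2\right).$$ *)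

theory Defs
  imports "HOL-Analysis.Analysis" "HOL-Probability.Probability"
begin

text \<open>
  The coordinates \<open>1, \<dots>, N\<close> are the elements of a finite linearly ordered index type \<open>'n\<close>;
  the coordinates \<open>1\<close> and \<open>N\<close> are \<open>Min UNIV\<close> and \<open>Max UNIV\<close>. The all-ones vector is
  \<open>1 :: real ^ 'n\<close>, and \<open>w \<bullet> 1\<close> is the sum of the entries of \<open>w\<close>.
\<close>

definition diag :: "real ^ 'n \<Rightarrow> real ^ 'n ^ 'n" where
  "diag x = (\<chi> i j. if i = j then x $ i else 0)"

definition e_last :: "real ^ 'n::{finite,linorder}" where
  "e_last = axis (Max UNIV) 1"

definition admissible ::
  "real ^ 'n::{finite,linorder} \<Rightarrow> real ^ 'n::{finite,linorder} \<Rightarrow> real ^ 'n::{finite,linorder} ^ 'n::{finite,linorder} \<Rightarrow> bool" where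
  "admissible x w Q \<longleftrightarrow>
     invertible Q \<and>
     e_last v* Q = w \<and>
     Q *v 1 = (w \<bullet> 1) *\<^sub>R e_last \<and>
     (\<forall>i j. i \<noteq> j \<longrightarrow> (Q ** diag x ** matrix_inv Q) $ i $ j \<le> 0)"

definition inv_cone :: "real ^ 'n ^ 'n \<Rightarrow> (real ^ 'n) set" where
  "inv_cone Q = {matrix_inv Q *v z | z. \<forall>i. 0 \<le> z $ i}"


subsection \<open>Drift step\<close>

definition drift ::
  "real ^ 'n \<Rightarrow> real ^ 'n \<Rightarrow> real ^ 'n \<Rightarrow> real \<Rightarrow> real \<Rightarrow> real ^ 'n \<Rightarrow> real ^ 'n" where
  "drift x w v0 \<theta> lam z = - (diag x *v (z - v0)) + (\<theta> - lam * (w \<bullet> z)) *\<^sub>R 1"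

definition drift_solution ::
  "real ^ 'n \<Rightarrow> real ^ 'n \<Rightarrow> real ^ 'n \<Rightarrow> real \<Rightarrow> real \<Rightarrow> real ^ 'n \<Rightarrow> (real \<Rightarrow> real ^ 'n) \<Rightarrow> bool" where
  "drift_solution x w v0 \<theta> lam z Z \<longleftrightarrow>
     Z 0 = z \<and>
     (\<forall>t\<ge>0. (Z has_vector_derivative drift x w v0 \<theta> lam (Z t)) (at t within {0..}))"

text \<open>
  Solutions are only unique on \<open>{0..}\<close>, not as functions on all of \<open>real\<close>,
  so the description operator ranges over the value at time \<open>h\<close>.
\<close>

definition drift_step ::
  "real ^ 'n \<Rightarrow> real ^ 'n \<Rightarrow> real ^ 'n \<Rightarrow> real \<Rightarrow> real \<Rightarrow> real ^ 'n \<Rightarrow> real \<Rightarrow> real ^ 'n" where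
  "drift_step x w v0 \<theta> lam z h = (THE y. \<exists>Z. drift_solution x w v0 \<theta> lam z Z \<and> Z h = y)"


subsection \<open>Diffusion step\<close>

definition cir_a :: real where
  "cir_a = (3 + sqrt 3) / 4"

definition cir_radicand :: "real \<Rightarrow> real \<Rightarrow> real" where
  "cir_radicand x z = (3 * x + (cir_a + 3/4)^2 * z) * z"

definition \<xi>\<^sub>1 :: "real \<Rightarrow> real \<Rightarrow> real" where
  "\<xi>\<^sub>1 x z = x + (cir_a + 3/4) * z - sqrt (cir_radicand x z)"

definition \<xi>\<^sub>2 :: "real \<Rightarrow> real \<Rightarrow> real" where
  "\<xi>\<^sub>2 x z = x + cir_a * z"

definition \<xi>\<^sub>3 :: "real \<Rightarrow> real \<Rightarrow> real" where
  "\<xi>\<^sub>3 x z = x + (cir_a + 3/4) * z + sqrt (cir_radicand x z)"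

definition m\<^sub>1 :: "real \<Rightarrow> real \<Rightarrow> real" where
  "m\<^sub>1 x z = x"

definition m\<^sub>2 :: "real \<Rightarrow> real \<Rightarrow> real" where
  "m\<^sub>2 x z = x^2 + x * z"

definition m\<^sub>3 :: "real \<Rightarrow> real \<Rightarrow> real" where
  "m\<^sub>3 x z = x^3 + 3 * x^2 * z + 3/2 * x * z^2"

definition p\<^sub>1 :: "real \<Rightarrow> real \<Rightarrow> real" where
  "p\<^sub>1 x z =
     (m\<^sub>1 x z * \<xi>\<^sub>2 x z * \<xi>\<^sub>3 x z - m\<^sub>2 x z * (\<xi>\<^sub>2 x z + \<xi>\<^sub>3 x z) + m\<^sub>3 x z) /
     (\<xi>\<^sub>1 x z * (\<xi>\<^sub>3 x z - \<xi>\<^sub>1 x z) * (\<xi>\<^sub>2 x z - \<xi>\<^sub>1 x z))"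

definition p\<^sub>2 :: "real \<Rightarrow> real \<Rightarrow> real" where
  "p\<^sub>2 x z =
     (m\<^sub>1 x z * \<xi>\<^sub>1 x z * \<xi>\<^sub>3 x z - m\<^sub>2 x z * (\<xi>\<^sub>1 x z + \<xi>\<^sub>3 x z) + m\<^sub>3 x z) /
     (\<xi>\<^sub>2 x z * (\<xi>\<^sub>3 x z - \<xi>\<^sub>2 x z) * (\<xi>\<^sub>1 x z - \<xi>\<^sub>2 x z))"

definition p\<^sub>3 :: "real \<Rightarrow> real \<Rightarrow> real" where
  "p\<^sub>3 x z =
     (m\<^sub>1 x z * \<xi>\<^sub>1 x z * \<xi>\<^sub>2 x z - m\<^sub>2 x z * (\<xi>\<^sub>1 x z + \<xi>\<^sub>2 x z) + m\<^sub>3 x z) /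
     (\<xi>\<^sub>3 x z * (\<xi>\<^sub>1 x z - \<xi>\<^sub>3 x z) * (\<xi>\<^sub>2 x z - \<xi>\<^sub>3 x z))"

text \<open>
  The law of the three-point variable, by Lileika and Mackevicius. For \<open>x, z > 0\<close> the list below is
  a probability distribution; for \<open>x < 0\<close> it need not be one, and \<^const>\<open>pmf_of_list\<close>
  is then an unspecified law.
\<close>

definition cir_law :: "real \<Rightarrow> real \<Rightarrow> real pmf" where
  "cir_law x z =
     (if x = 0 \<or> z = 0 then return_pmf x
      else pmf_of_list [(\<xi>\<^sub>1 x z, p\<^sub>1 x z), (\<xi>\<^sub>2 x z, p\<^sub>2 x z), (\<xi>\<^sub>3 x z, p\<^sub>3 x z)])"

definition cir_z :: "real ^ 'n \<Rightarrow> real \<Rightarrow> real \<Rightarrow> real" where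
  "cir_z w \<nu> h = \<nu>^2 * (w \<bullet> 1)^2 * h"

definition diffusion_step :: "real ^ 'n \<Rightarrow> real \<Rightarrow> real ^ 'n \<Rightarrow> real \<Rightarrow> (real ^ 'n) pmf" where
  "diffusion_step w \<nu> y h =
     map_pmf (\<lambda>Y. y + ((Y - w \<bullet> y) / (w \<bullet> 1)) *\<^sub>R 1) (cir_law (w \<bullet> y) (cir_z w \<nu> h))"


subsection \<open>Strang splitting\<close>

definition A_CIR ::
  "real ^ 'n \<Rightarrow> real ^ 'n \<Rightarrow> real ^ 'n \<Rightarrow> real \<Rightarrow> real \<Rightarrow> real \<Rightarrow> real ^ 'n \<Rightarrow> real \<Rightarrow> (real ^ 'n) pmf" where
  "A_CIR x w v0 \<theta> lam \<nu> v h =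
     map_pmf (\<lambda>s. drift_step x w v0 \<theta> lam s (h/2))
       (diffusion_step w \<nu> (drift_step x w v0 \<theta> lam v (h/2)) h)"

text \<open>
  The number under the only argument-dependent square root evaluated in one step of the algorithm.
\<close>

definition A_CIR_radicand ::
  "real ^ 'n \<Rightarrow> real ^ 'n \<Rightarrow> real ^ 'n \<Rightarrow> real \<Rightarrow> real \<Rightarrow> real \<Rightarrow> real ^ 'n \<Rightarrow> real \<Rightarrow> real" where
  "A_CIR_radicand x w v0 \<theta> lam \<nu> v h =
     cir_radicand (w \<bullet> drift_step x w v0 \<theta> lam v (h/2)) (cir_z w \<nu> h)"

end

theory Submission
  imports Defs
begin

text \<open>
  Everything becomes transparent in the coordinates \<open>u = Q z\<close>, in which the cone
  \<open>Q\<^sup>-\<^sup>1 \<real>\<^sub>+\<^sup>N\<close> is the nonnegative orthant and \<open>w \<bullet> z\<close>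
  is the last coordinate of \<open>u\<close>.

  Since \<open>diag(x) v\<^sub>0 = \<mu> 1\<close> and \<open>Q\<close> sends the all-ones vector to a nonnegative multiple
  of \<open>e\<^sub>N\<close>, the drift equation reads \<open>u' = M u + b\<close> with
  \<open>b = (\<mu> + \<theta>) (w \<bullet> 1) e\<^sub>N \<ge> 0\<close> and
  \<open>M = - Q diag(x) Q\<^sup>-\<^sup>1 - \<lambda> (w \<bullet> 1) e\<^sub>N e\<^sub>N\<^sup>T\<close>.
  Admissibility makes the off-diagonal entries of \<open>M\<close> nonnegative, and the \<open>\<lambda>\<close>-term only
  touches the diagonal. Such linear systems leave the orthant invariant
  (\<open>metzler_ode_nonneg_solution\<close>), so the drift step preserves the cone
  (\<open>drift_step_in_inv_cone\<close>). The drift step is defined by a description operator, which is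
  resolved by uniqueness of solutions (\<open>lipschitz_ode_unique\<close>).

  The diffusion step moves \<open>z\<close> along the all-ones vector, hence \<open>u\<close> along \<open>e\<^sub>N\<close>, by
  exactly the amount that replaces the last coordinate by a value of the three-point variable. As this
  variable is nonnegative when started from \<open>w \<bullet> z \<ge> 0\<close> (\<open>cir_law_nonneg\<close>), the cone is
  preserved again. The radicand is nonnegative for the same reason: it is evaluated at a point
  of the cone.
\<close>

section \<open>Cones given by matrices\<close>

lemma matrix_inv_mult_cancel:
  fixes Q :: "real ^ 'n ^ 'n"
  assumes "invertible Q"
  shows "Q *v (matrix_inv Q *v z) = z" "matrix_inv Q *v (Q *v z) = z"
proof -
  have "Q ** matrix_inv Q = mat 1 \<and> matrix_inv Q ** Q = mat 1"
    using assms unfolding invertible_def matrix_inv_def by (rule someI_ex)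
  then show "Q *v (matrix_inv Q *v z) = z" "matrix_inv Q *v (Q *v z) = z"
    by (simp_all add: matrix_vector_mul_assoc)
qed

lemma inv_cone_iff:
  fixes Q :: "real ^ 'n ^ 'n"
  assumes "invertible Q"
  shows "v \<in> inv_cone Q \<longleftrightarrow> (\<forall>i. 0 \<le> (Q *v v) $ i)"
proof
  assume "v \<in> inv_cone Q"
  then show "\<forall>i. 0 \<le> (Q *v v) $ i"
    by (auto simp: inv_cone_def matrix_inv_mult_cancel[OF assms])
next
  assume "\<forall>i. 0 \<le> (Q *v v) $ i"
  then show "v \<in> inv_cone Q"
    unfolding inv_cone_def using matrix_inv_mult_cancel(2)[OF assms, of v, symmetric] by blast
qed

section \<open>Linear differential equations\<close>

text \<open>
  Gronwall's argument: for the difference \<open>d\<close> of two solutions, the function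
  \<open>exp (- 2 L t) (d \<bullet> d)\<close> has nonpositive derivative and starts at zero.
\<close>

lemma lipschitz_ode_unique:
  fixes X Y :: "real \<Rightarrow> 'a::real_inner"
  assumes X: "\<And>t. 0 \<le> t \<Longrightarrow> (X has_vector_derivative f (X t)) (at t within {0..})"
    and Y: "\<And>t. 0 \<le> t \<Longrightarrow> (Y has_vector_derivative f (Y t)) (at t within {0..})"
    and lip: "\<And>a b. norm (f a - f b) \<le> L * norm (a - b)"
    and init: "X 0 = Y 0" and h: "0 \<le> h"
  shows "X h = Y h"
proof -
  define d where "d t = X t - Y t" for t
  define g where "g t = exp (- 2 * L * t) * (d t \<bullet> d t)" for t
  define g' where "g' t = exp (- 2 * L * t) * (2 * (d t \<bullet> (f (X t) - f (Y t))) - 2 * L * (d t \<bullet> d t))" for t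
  have dd: "(d has_vector_derivative (f (X t) - f (Y t))) (at t within {0..h})" if "0 \<le> t" for t
    unfolding d_def
    using has_vector_derivative_within_subset[OF has_vector_derivative_diff[OF X[OF that] Y[OF that]], of "{0..h}"]
    by auto
  have "(g has_derivative (*) (g' t)) (at t within {0..h})" if "0 \<le> t" for t
  proof -
    have "((\<lambda>t. d t \<bullet> d t) has_derivative
        (\<lambda>u. d t \<bullet> (u *\<^sub>R (f (X t) - f (Y t))) + (u *\<^sub>R (f (X t) - f (Y t))) \<bullet> d t)) (at t within {0..h})"
      by (rule has_derivative_inner; use dd[OF that] in \<open>simp add: has_vector_derivative_def\<close>)
    moreover have "((\<lambda>t. exp (- 2 * L * t)) has_derivative (\<lambda>u. exp (- 2 * L * t) * (- 2 * L * u))) (at t within {0..h})"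
      by (auto intro!: derivative_eq_intros)
    ultimately show ?thesis
      unfolding g_def g'_def
      by (intro has_derivative_mult[THEN has_derivative_eq_rhs])
        (auto simp: fun_eq_iff algebra_simps inner_commute)
  qed
  then obtain t where t: "0 \<le> t" "g h - g 0 = g' t * (h - 0)"
    using mvt_very_simple[OF h, of g "\<lambda>t. (*) (g' t)"] by auto
  have "d t \<bullet> (f (X t) - f (Y t)) \<le> norm (d t) * norm (f (X t) - f (Y t))"
    by (rule norm_cauchy_schwarz)
  also have "\<dots> \<le> norm (d t) * (L * norm (d t))"
    unfolding d_def by (intro mult_left_mono lip) auto
  also have "\<dots> = L * (d t \<bullet> d t)"
    by (simp add: power2_norm_eq_inner[symmetric] power2_eq_square)
  finally have "g' t \<le> 0"
    unfolding g'_def by (simp add: mult_nonneg_nonpos)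
  with t(2) h have "g h \<le> g 0"
    by (metis diff_le_0_iff_le diff_zero mult_nonpos_nonneg)
  then have "exp (- 2 * L * h) * (d h \<bullet> d h) \<le> 0"
    using init by (simp add: g_def d_def)
  then have "d h \<bullet> d h \<le> 0"
    by (simp add: mult_le_0_iff)
  then have "d h = 0"
    using inner_gt_zero_iff[of "d h"] by linarith
  then show ?thesis
    by (simp add: d_def)
qed

text \<open>
  These are the Taylor coefficients, up to the factor \<open>1 / n!\<close>, of the solution of
  \<open>V' = P V + exp (K t) b\<close> with \<open>V 0 = u\<close>.
\<close>

primrec exp_coeff :: "real ^ 'n ^ 'n \<Rightarrow> real \<Rightarrow> real ^ 'n \<Rightarrow> real ^ 'n \<Rightarrow> nat \<Rightarrow> real ^ 'n" where
  "exp_coeff P K b u 0 = u"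
| "exp_coeff P K b u (Suc n) = P *v exp_coeff P K b u n + K ^ n *\<^sub>R b"

lemma exp_coeff_nonneg:
  assumes "\<And>i j. 0 \<le> P $ i $ j" "0 \<le> K" "\<And>i. 0 \<le> b $ i" "\<And>i. 0 \<le> u $ i"
  shows "0 \<le> exp_coeff P K b u n $ i"
proof (induction n arbitrary: i)
  case 0
  show ?case by (simp add: assms)
next
  case (Suc n)
  have "0 \<le> (\<Sum>j\<in>UNIV. P $ i $ j * exp_coeff P K b u n $ j)"
    by (intro sum_nonneg mult_nonneg_nonneg assms Suc)
  then show ?case by (simp add: matrix_vector_mult_def assms)
qed

text \<open>
  Geometric growth is what makes the exponential series with these coefficients converge everywhere.
\<close>

lemma exp_coeff_growth:
  assumes "0 \<le> K"
  obtains C L where "\<And>n. norm (exp_coeff P K b u n) \<le> C * L ^ n" "0 \<le> C" "0 \<le> L"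
proof -
  obtain B where B: "0 \<le> B" "\<And>v. norm (P *v v) \<le> norm v * B"
    using bounded_linear.nonneg_bounded[OF matrix_vector_mul_bounded_linear[of P]] by blast
  define C where "C = norm u + norm b"
  \<comment> \<open>The rate has to absorb both \<open>P\<close> and the powers of \<open>K\<close> in the recursion;
    the summand \<open>1\<close> pays for adding \<open>K ^ n *\<^sub>R b\<close>.\<close>
  define L where "L = B + K + 1"
  have CL: "0 \<le> C" "0 \<le> L" by (auto simp: C_def L_def B assms)
  have "norm (exp_coeff P K b u n) \<le> C * L ^ n" for n
  proof (induction n)
    case 0
    then show ?case by (simp add: C_def)
  next
    case (Suc n)
    have "norm (exp_coeff P K b u (Suc n)) \<le> norm (exp_coeff P K b u n) * B + K ^ n * norm b"
      using B(2)[of "exp_coeff P K b u n"] assms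
      by (auto intro!: norm_triangle_le)
    also have "\<dots> \<le> C * L ^ n * B + L ^ n * C"
      using Suc assms B(1) by (intro add_mono mult_mono power_mono) (auto simp: CL C_def L_def)
    also have "\<dots> \<le> C * L ^ n * (B + K + 1)"
      using assms CL by (simp add: algebra_simps)
    finally show ?case by (simp only: L_def power_Suc2 mult.assoc)
  qed
  then show thesis using that CL by blast
qed

lemma has_vector_derivative_vec_lambda:
  fixes f :: "real \<Rightarrow> real ^ 'n"
  assumes "\<And>i. ((\<lambda>t. f t $ i) has_real_derivative f' $ i) (at t)"
  shows "(f has_vector_derivative f') (at t)"
  unfolding has_vector_derivative_def
proof (subst has_derivative_componentwise_within, intro ballI)
  fix e :: "real ^ 'n" assume "e \<in> Basis"
  then obtain i where "e = axis i 1" by (auto simp: Basis_vec_def)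
  then show "((\<lambda>t. f t \<bullet> e) has_derivative (\<lambda>u. (u *\<^sub>R f') \<bullet> e)) (at t)"
    using assms[of i] by (simp add: inner_axis has_field_derivative_def mult_commute_abs)
qed

text \<open>
  If \<open>K\<close> dominates the moduli of the diagonal entries, then \<open>P = M + K I\<close> has nonnegative entries.
  Multiplying a solution by \<open>exp (K t)\<close> turns \<open>U' = M U + b\<close> into
  \<open>V' = P V + exp (K t) b\<close>, whose power series solution has only nonnegative coefficients. This
  gives existence and nonnegativity at the same time.
\<close>

lemma metzler_ode_nonneg_solution:
  fixes M :: "real ^ 'n ^ 'n"
  assumes off: "\<And>i j. i \<noteq> j \<Longrightarrow> 0 \<le> M $ i $ j"
    and b: "\<And>i. 0 \<le> b $ i" and u: "\<And>i. 0 \<le> u $ i"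
  obtains U where "U 0 = u" "\<And>t. (U has_vector_derivative M *v U t + b) (at t)"
    "\<And>t i. 0 \<le> t \<Longrightarrow> 0 \<le> U t $ i"
proof -
  define K where "K = (\<Sum>i\<in>UNIV. \<bar>M $ i $ i\<bar>)"
  have K: "0 \<le> K" by (simp add: K_def sum_nonneg)
  define P where "P = M + K *\<^sub>R mat 1"
  have "\<bar>M $ i $ i\<bar> \<le> K" for i
    unfolding K_def by (rule member_le_sum) auto
  then have "0 \<le> M $ i $ i + K" for i
    by (metis abs_ge_minus_self add.commute diff_0 diff_le_eq order_trans)
  then have P: "0 \<le> P $ i $ j" for i j
    using off[of i j] by (cases "i = j") (auto simp: P_def mat_def)
  define c where "c = exp_coeff P K b u"
  define a where "a i n = c n $ i / fact n" for i n
  define S where "S i t = (\<Sum>n. a i n * t ^ n)" for i t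
  have summable: "summable (\<lambda>n. a i n * t ^ n)" for i t
  proof -
    obtain C L where C: "\<And>n. norm (c n) \<le> C * L ^ n" "0 \<le> C" "0 \<le> L"
      unfolding c_def using exp_coeff_growth[OF K] by blast
    have "summable (\<lambda>n. C * (inverse (fact n) * (L * \<bar>t\<bar>) ^ n))"
      by (intro summable_mult summable_exp)
    then show ?thesis
    proof (rule summable_comparison_test'[where N = 0])
      fix n
      have "\<bar>c n $ i\<bar> \<le> C * L ^ n"
        using component_le_norm_cart[of "c n" i] C(1)[of n] by linarith
      then have "\<bar>c n $ i\<bar> * (inverse (fact n) * \<bar>t\<bar> ^ n) \<le> C * L ^ n * (inverse (fact n) * \<bar>t\<bar> ^ n)"
        by (rule mult_right_mono) simp
      then show "norm (a i n * t ^ n) \<le> C * (inverse (fact n) * (L * \<bar>t\<bar>) ^ n)"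
        by (simp add: a_def abs_mult power_abs power_mult_distrib divide_inverse ac_simps)
    qed
  qed
  have S': "(S i has_real_derivative (\<Sum>j\<in>UNIV. P $ i $ j * S j t) + b $ i * exp (K * t)) (at t)" for i t
  proof -
    have "diffs (a i) n * t ^ n = (\<Sum>j\<in>UNIV. P $ i $ j * (a j n * t ^ n)) + b $ i * ((K * t) ^ n /\<^sub>R fact n)" for n
    proof -
      have "diffs (a i) n = c (Suc n) $ i / fact n"
        by (simp add: diffs_def a_def del: of_nat_Suc)
      also have "\<dots> = (\<Sum>j\<in>UNIV. P $ i $ j * a j n) + b $ i * (K ^ n /\<^sub>R fact n)"
        by (simp add: a_def c_def matrix_vector_mult_def add_divide_distrib sum_divide_distrib divide_inverse sum_distrib_left
            distrib_left ac_simps)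
      finally show ?thesis
        by (simp add: distrib_right distrib_left sum_distrib_left power_mult_distrib ac_simps)
    qed
    moreover have "(\<lambda>n. (\<Sum>j\<in>UNIV. P $ i $ j * (a j n * t ^ n)) + b $ i * ((K * t) ^ n /\<^sub>R fact n)) sums
        ((\<Sum>j\<in>UNIV. P $ i $ j * S j t) + b $ i * exp (K * t))"
      unfolding S_def
      by (intro sums_add sums_sum sums_mult summable_sums summable exp_converges)
    ultimately have "(\<Sum>n. diffs (a i) n * t ^ n) = (\<Sum>j\<in>UNIV. P $ i $ j * S j t) + b $ i * exp (K * t)"
      by (simp add: sums_iff)
    then show ?thesis
      using termdiffs_strong_converges_everywhere[OF summable, of i t]
      by (simp add: S_def[abs_def])
  qed
  define U where "U t = (\<chi> i. exp (- K * t) * S i t)" for t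
  show thesis
  proof
    show "U 0 = u"
      using powser_zero[of "a _"] by (simp add: vec_eq_iff U_def S_def a_def c_def)
    show "(U has_vector_derivative M *v U t + b) (at t)" for t
    proof (rule has_vector_derivative_vec_lambda)
      fix i
      have M: "M $ i $ j = P $ i $ j - (if j = i then K else 0)" for j
        by (auto simp: P_def mat_def)
      have "(M *v U t) $ i = (\<Sum>j\<in>UNIV. P $ i $ j * U t $ j) - K * U t $ i"
        by (simp add: matrix_vector_mult_def M left_diff_distrib sum_subtractf if_distrib[of "\<lambda>y. y * _"] cong: if_cong)
      moreover have "(\<Sum>j\<in>UNIV. P $ i $ j * U t $ j) = exp (- K * t) * (\<Sum>j\<in>UNIV. P $ i $ j * S j t)"
        by (simp add: U_def sum_distrib_left algebra_simps)
      moreover have "exp (- K * t) * exp (K * t) = 1"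
        by (simp add: exp_add[symmetric])
      ultimately have eq: "(M *v U t + b) $ i = exp (- K * t) * (- K) * S i t
          + ((\<Sum>j\<in>UNIV. P $ i $ j * S j t) + b $ i * exp (K * t)) * exp (- K * t)"
        by (simp add: U_def algebra_simps)
      show "((\<lambda>t. U t $ i) has_real_derivative (M *v U t + b) $ i) (at t)"
        unfolding eq by (auto simp: U_def intro!: derivative_eq_intros S')
    qed
    show "0 \<le> U t $ i" if "0 \<le> t" for t i
      using that exp_coeff_nonneg[OF P K b u] summable
      by (auto simp: U_def S_def a_def c_def intro!: mult_nonneg_nonneg suminf_nonneg)
  qed
qed

section \<open>The drift step\<close>

lemma drift_step_eq:
  fixes x w :: "real ^ 'n"
  assumes Z: "drift_solution x w v0 \<theta> lam z Z" and h: "0 \<le> h"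
  shows "drift_step x w v0 \<theta> lam z h = Z h"
proof -
  define F where "F u = - (diag x *v u) - (lam * (w \<bullet> u)) *\<^sub>R (1 :: real ^ 'n)" for u
  have "linear F"
    unfolding F_def by (intro linearI) (auto simp: algebra_simps matrix_vector_right_distrib matrix_vector_mult_scaleR)
  then have "bounded_linear F"
    by (simp add: linear_conv_bounded_linear)
  then obtain L where L: "norm (F u) \<le> norm u * L" for u
    using bounded_linear.bounded by blast
  have diff: "drift x w v0 \<theta> lam a - drift x w v0 \<theta> lam b = F (a - b)" for a b
    by (simp add: drift_def F_def matrix_vector_mult_diff_distrib inner_diff_right algebra_simps)
  have lip: "norm (drift x w v0 \<theta> lam a - drift x w v0 \<theta> lam b) \<le> L * norm (a - b)" for a b
    using L[of "a - b"] by (simp only: diff mult.commute)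
  have "X h = Z h" if "drift_solution x w v0 \<theta> lam z X" for X
    by (rule lipschitz_ode_unique[OF _ _ lip _ h]) (use that Z in \<open>auto simp: drift_solution_def\<close>)
  then show ?thesis
    unfolding drift_step_def using Z by blast
qed

lemma diag_mult_matrix_inv:
  assumes "\<And>i. x $ i \<noteq> 0"
  shows "diag x *v (matrix_inv (diag x) *v v) = v"
proof (rule matrix_inv_mult_cancel)
  have "diag x ** diag (\<chi> i. 1 / x $ i) = mat 1"
    using assms by (simp add: diag_def matrix_matrix_mult_def mat_def vec_eq_iff if_distrib[of "\<lambda>y. y * _"] cong: if_cong)
  then show "invertible (diag x)"
    using invertible_right_inverse by blast
qed

text \<open>
  The last row of \<open>Q\<close> is \<open>w\<close>, so points of the cone have nonnegative weighted sum.
\<close>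

lemma admissible_inner:
  assumes "admissible x w Q"
  shows "w \<bullet> z = (Q *v z) $ Max UNIV"
proof -
  have "w \<bullet> z = (e_last v* Q) \<bullet> z"
    using assms by (simp add: admissible_def)
  also have "\<dots> = (Q *v z) $ Max UNIV"
    by (simp add: dot_lmul_matrix e_last_def inner_axis')
  finally show ?thesis .
qed

text \<open>
  The drift field is conjugate under \<open>Q\<close> to an affine field whose matrix has nonnegative
  off-diagonal entries and whose constant term is nonnegative. The nonnegative solution of the
  conjugate equation is transported back by \<open>Q\<^sup>-\<^sup>1\<close>.
\<close>

lemma drift_step_in_inv_cone:
  fixes x w v0 :: "real ^ 'n::{finite,linorder}"
  assumes adm: "admissible x w Q" and v0: "diag x *v v0 = \<mu> *\<^sub>R 1"
    and nonneg: "0 \<le> \<mu>" "0 \<le> \<theta>" "0 \<le> w \<bullet> 1"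
    and z: "z \<in> inv_cone Q" and h: "0 \<le> h"
  shows "drift_step x w v0 \<theta> lam z h \<in> inv_cone Q"
proof -
  have inv: "invertible Q" and Q1: "Q *v 1 = (w \<bullet> 1) *\<^sub>R e_last"
    and off: "\<And>i j. i \<noteq> j \<Longrightarrow> (Q ** diag x ** matrix_inv Q) $ i $ j \<le> 0"
    using adm by (auto simp: admissible_def)
  define A where "A = Q ** diag x ** matrix_inv Q"
  \<comment> \<open>The feedback through \<open>w \<bullet> z\<close>, the last coordinate of \<open>Q *v z\<close>, acts in direction
    \<open>e_last\<close> and so changes only one diagonal entry.\<close>
  define M where "M = (\<chi> i j. - A $ i $ j - (if i = j then lam * (w \<bullet> 1) * e_last $ i else 0))"
  define b where "b = ((\<mu> + \<theta>) * (w \<bullet> 1)) *\<^sub>R (e_last :: real ^ 'n::{finite,linorder})"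
  have M: "M *v u = - (A *v u) - (lam * (w \<bullet> 1) * u $ Max UNIV) *\<^sub>R e_last" for u
    by (simp add: M_def matrix_vector_mult_def vec_eq_iff left_diff_distrib sum_subtractf sum_negf
        if_distrib[of "\<lambda>y. y * _"] e_last_def axis_def cong: if_cong)
  have conj: "Q *v drift x w v0 \<theta> lam y = M *v (Q *v y) + b" for y
  proof -
    have "A *v (Q *v y) = Q *v (diag x *v y)"
      by (simp add: A_def matrix_vector_mul_assoc[symmetric] matrix_inv_mult_cancel[OF inv])
    moreover have "drift x w v0 \<theta> lam y = - (diag x *v y) + (\<mu> + \<theta> - lam * (w \<bullet> y)) *\<^sub>R 1"
      by (simp add: drift_def matrix_vector_mult_diff_distrib v0 algebra_simps)
    then have "Q *v drift x w v0 \<theta> lam y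
        = - (Q *v (diag x *v y)) + ((\<mu> + \<theta> - lam * (w \<bullet> y)) * (w \<bullet> 1)) *\<^sub>R e_last"
      by (simp add: matrix_vector_mult_diff_distrib matrix_vector_mult_scaleR Q1)
    ultimately show ?thesis
      by (simp add: M b_def admissible_inner[OF adm, of y] algebra_simps)
  qed
  have M_off: "0 \<le> M $ i $ j" if "i \<noteq> j" for i j
    using that off[OF that] by (simp add: M_def A_def)
  have b_nonneg: "0 \<le> b $ i" for i
    using nonneg by (simp add: b_def e_last_def axis_def)
  have Qz: "0 \<le> (Q *v z) $ i" for i
    using z by (simp add: inv_cone_iff[OF inv])
  obtain U where U: "U 0 = Q *v z" "\<And>t. (U has_vector_derivative M *v U t + b) (at t)"
    "\<And>t i. 0 \<le> t \<Longrightarrow> 0 \<le> U t $ i"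
    by (rule metzler_ode_nonneg_solution[OF M_off b_nonneg Qz]) auto
  define Z where "Z t = matrix_inv Q *v U t" for t
  have "(Z has_vector_derivative drift x w v0 \<theta> lam (Z t)) (at t)" for t
  proof -
    have "M *v U t + b = Q *v drift x w v0 \<theta> lam (Z t)"
      by (simp add: conj Z_def matrix_inv_mult_cancel[OF inv])
    then show ?thesis
      using bounded_linear.has_vector_derivative[OF matrix_vector_mul_bounded_linear U(2), of "matrix_inv Q" t]
      by (simp add: Z_def[abs_def] matrix_inv_mult_cancel[OF inv])
  qed
  then have "drift_solution x w v0 \<theta> lam z Z"
    by (auto simp: drift_solution_def Z_def U(1) matrix_inv_mult_cancel[OF inv]
        intro: has_vector_derivative_at_within)
  then have "drift_step x w v0 \<theta> lam z h = Z h"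
    using h by (rule drift_step_eq)
  then show ?thesis
    using U(3)[OF h] by (simp add: inv_cone_iff[OF inv] Z_def matrix_inv_mult_cancel[OF inv])
qed

section \<open>The three-point law\<close>

lemma cir_radicand_nonneg:
  assumes "0 \<le> x" "0 \<le> z"
  shows "0 \<le> cir_radicand x z"
  using assms by (simp add: cir_radicand_def)

lemma cir_a_bounds: "1 < cir_a" "cir_a < 6/5"
proof -
  have "1 < sqrt 3" by simp
  then show "1 < cir_a" by (simp add: cir_a_def)
  have "sqrt 3 < 9/5" by (rule real_less_lsqrt) (auto simp: power2_eq_square)
  then show "cir_a < 6/5" by (simp add: cir_a_def)
qed

text \<open>
  Write \<open>c = cir_a + 3/4\<close> and \<open>r\<close> for the square root of the radicand. Positivity of \<open>\<xi>\<^sub>1\<close> is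
  \<open>r < x + c z\<close>, which after squaring amounts to \<open>0 < x\<^sup>2 + (2 c - 3) x z\<close>.
  The gaps are \<open>\<xi>\<^sub>2 - \<xi>\<^sub>1 = r - 3/4 z\<close> and \<open>\<xi>\<^sub>3 - \<xi>\<^sub>2 = r + 3/4 z\<close>,
  and \<open>r > c z > 3/4 z\<close>.
\<close>

lemma cir_points_order:
  assumes x: "0 < x" and z: "0 < z"
  shows "0 < \<xi>\<^sub>1 x z" "\<xi>\<^sub>1 x z < \<xi>\<^sub>2 x z" "\<xi>\<^sub>2 x z < \<xi>\<^sub>3 x z"
proof -
  note a = cir_a_bounds
  have "0 < x^2 + (2 * cir_a - 3/2) * (x * z)"
    using a x z by (intro add_pos_nonneg) auto
  then have "sqrt (cir_radicand x z) < x + (cir_a + 3/4) * z"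
    using a x z
    by (intro real_less_lsqrt) (auto simp: cir_radicand_def power2_eq_square algebra_simps)
  then show "0 < \<xi>\<^sub>1 x z" by (simp add: \<xi>\<^sub>1_def)
  have "(3/4 * z)^2 < cir_radicand x z"
  proof -
    have "(3/4 * z)^2 \<le> ((cir_a + 3/4) * z)^2"
      using a z by (intro power_mono mult_right_mono) auto
    also have "\<dots> < cir_radicand x z"
      using x z by (simp add: cir_radicand_def power2_eq_square algebra_simps)
    finally show ?thesis .
  qed
  then have "3/4 * z < sqrt (cir_radicand x z)"
    by (rule real_less_rsqrt)
  then show "\<xi>\<^sub>1 x z < \<xi>\<^sub>2 x z"
    by (simp add: \<xi>\<^sub>1_def \<xi>\<^sub>2_def algebra_simps)
  have "0 \<le> sqrt (cir_radicand x z)"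
    using x z by (simp add: cir_radicand_nonneg)
  moreover have "\<xi>\<^sub>3 x z = \<xi>\<^sub>2 x z + 3/4 * z + sqrt (cir_radicand x z)"
    by (simp add: \<xi>\<^sub>3_def \<xi>\<^sub>2_def algebra_simps)
  ultimately show "\<xi>\<^sub>2 x z < \<xi>\<^sub>3 x z"
    using z by linarith
qed

text \<open>
  The outer points are conjugate roots of a quadratic polynomial, so their sum and product are
  free of the square root.
\<close>

lemma cir_points_sym:
  assumes "0 < x" "0 < z"
  shows "\<xi>\<^sub>1 x z + \<xi>\<^sub>3 x z = 2 * x + 2 * (cir_a + 3/4) * z"
    and "\<xi>\<^sub>1 x z * \<xi>\<^sub>3 x z = x^2 + (2 * cir_a - 3/2) * x * z"
proof -
  show "\<xi>\<^sub>1 x z + \<xi>\<^sub>3 x z = 2 * x + 2 * (cir_a + 3/4) * z"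
    by (simp add: \<xi>\<^sub>1_def \<xi>\<^sub>3_def)
  have "\<xi>\<^sub>1 x z * \<xi>\<^sub>3 x z = (x + (cir_a + 3/4) * z)^2 - (sqrt (cir_radicand x z))^2"
    by (simp add: \<xi>\<^sub>1_def \<xi>\<^sub>3_def power2_eq_square algebra_simps)
  also have "\<dots> = x^2 + (2 * cir_a - 3/2) * x * z"
    using assms by (simp add: cir_radicand_nonneg) (simp add: cir_radicand_def power2_eq_square algebra_simps)
  finally show "\<xi>\<^sub>1 x z * \<xi>\<^sub>3 x z = x^2 + (2 * cir_a - 3/2) * x * z" .
qed

text \<open>
  Multiplied by \<open>a\<close>, \<open>b\<close>, \<open>c\<close>, the three quotients are the weights on these nodes that
  integrate \<open>1\<close>, \<open>t\<close>, \<open>t\<^sup>2\<close> to \<open>m1\<close>, \<open>m2\<close>, \<open>m3\<close>. Summing the quotients themselves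
  means integrating \<open>1 / t\<close>, which on the nodes agrees with the quadratic polynomial
  \<open>(e\<^sub>2 - e\<^sub>1 t + t\<^sup>2) / e\<^sub>3\<close> in the elementary symmetric functions of the nodes.
\<close>

lemma lagrange_weights_sum:
  fixes a b c :: real
  assumes "a \<noteq> 0" "b \<noteq> 0" "c \<noteq> 0" "a \<noteq> b" "a \<noteq> c" "b \<noteq> c"
  shows "(m1 * b * c - m2 * (b + c) + m3) / (a * (c - a) * (b - a)) +
         (m1 * a * c - m2 * (a + c) + m3) / (b * (c - b) * (a - b)) +
         (m1 * a * b - m2 * (a + b) + m3) / (c * (a - c) * (b - c)) =
         (m1 * (a * b + a * c + b * c) - m2 * (a + b + c) + m3) / (a * b * c)"
proof -
  have ne: "c - a \<noteq> 0" "b - a \<noteq> 0" "c - b \<noteq> 0" "a - b \<noteq> 0" "a - c \<noteq> 0" "b - c \<noteq> 0"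
    using assms by auto
  define D where "D = a * b * c * ((b - a) * (c - a) * (c - b))"
  have D: "D \<noteq> 0"
    using ne assms(1-3) by (simp add: D_def)
  have common: "n / d = n * e / D" if "d * e = D" for n d e
    using that D by auto
  have 1: "n / (a * (c - a) * (b - a)) = n * (b * c * (c - b)) / D" for n
    by (rule common) (simp add: D_def)
  have 2: "n / (b * (c - b) * (a - b)) = n * (- (a * c * (c - a))) / D" for n
    by (rule common) (simp add: D_def algebra_simps)
  have 3: "n / (c * (a - c) * (b - c)) = n * (a * b * (b - a)) / D" for n
    by (rule common) (simp add: D_def algebra_simps)
  have 4: "n / (a * b * c) = n * ((b - a) * (c - a) * (c - b)) / D" for n
    by (rule common) (simp add: D_def)
  show ?thesis
    unfolding 1 2 3 4 add_divide_distrib[symmetric] by (rule arg_cong[where f = "\<lambda>n. n / D"]) algebra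
qed

text \<open>
  With \<open>e\<^sub>k\<close> the elementary symmetric functions of the \<open>\<xi>\<^sub>i\<close>, the total mass is one because
  \<open>e\<^sub>2 m\<^sub>1 - e\<^sub>1 m\<^sub>2 + m\<^sub>3 = e\<^sub>3\<close>. Pairing \<open>\<xi>\<^sub>1\<close> with \<open>\<xi>\<^sub>3\<close> turns this into a polynomial
  identity in \<open>x\<close>, \<open>z\<close> and \<open>cir_a\<close>.
\<close>

lemma cir_weights_sum:
  assumes x: "0 < x" and z: "0 < z"
  shows "p\<^sub>1 x z + p\<^sub>2 x z + p\<^sub>3 x z = 1"
proof -
  note o = cir_points_order[OF assms]
  have "m\<^sub>1 x z * (\<xi>\<^sub>1 x z * \<xi>\<^sub>3 x z + \<xi>\<^sub>2 x z * (\<xi>\<^sub>1 x z + \<xi>\<^sub>3 x z))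
      - m\<^sub>2 x z * (\<xi>\<^sub>2 x z + (\<xi>\<^sub>1 x z + \<xi>\<^sub>3 x z)) + m\<^sub>3 x z
      = \<xi>\<^sub>2 x z * (\<xi>\<^sub>1 x z * \<xi>\<^sub>3 x z)"
    unfolding cir_points_sym[OF assms] m\<^sub>1_def m\<^sub>2_def m\<^sub>3_def \<xi>\<^sub>2_def
    by (simp add: power2_eq_square power3_eq_cube field_simps)
  then have "m\<^sub>1 x z * (\<xi>\<^sub>1 x z * \<xi>\<^sub>2 x z + \<xi>\<^sub>1 x z * \<xi>\<^sub>3 x z + \<xi>\<^sub>2 x z * \<xi>\<^sub>3 x z)
      - m\<^sub>2 x z * (\<xi>\<^sub>1 x z + \<xi>\<^sub>2 x z + \<xi>\<^sub>3 x z) + m\<^sub>3 x z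
      = \<xi>\<^sub>1 x z * \<xi>\<^sub>2 x z * \<xi>\<^sub>3 x z"
    by (simp add: algebra_simps)
  with o show ?thesis
    unfolding p\<^sub>1_def p\<^sub>2_def p\<^sub>3_def by (subst lagrange_weights_sum) auto
qed

text \<open>
  The signs of the denominators are read off from the order of the points. For \<open>p\<^sub>2\<close> the numerator
  is free of the square root and equals \<open>- x z (2 x + 2 cir_a z)\<close>. For \<open>p\<^sub>1\<close> and \<open>p\<^sub>3\<close> it is
  \<open>x z (x + e z \<plusminus> (cir_a - 1) r)\<close>, with \<open>r\<close> the square root of the radicand; in the minus case
  the small factor \<open>cir_a - 1 < 1/5\<close> and the crude bound \<open>r \<le> 2 x + 2 z\<close> suffice.
\<close>

lemma cir_weights_nonneg:
  assumes x: "0 < x" and z: "0 < z"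
  shows "0 \<le> p\<^sub>1 x z" "0 \<le> p\<^sub>2 x z" "0 \<le> p\<^sub>3 x z"
proof -
  note o = cir_points_order[OF assms] and a = cir_a_bounds
  define r where "r = sqrt (cir_radicand x z)"
  \<comment> \<open>The coefficient of \<open>x * z^2\<close> in the part of the numerators of \<open>p\<^sub>1\<close> and \<open>p\<^sub>3\<close>
    that is free of the square root.\<close>
  define e where "e = cir_a^2 - 5/4 * cir_a + 3/4"
  have r: "0 \<le> r"
    using x z by (simp add: r_def cir_radicand_nonneg)
  have e: "1/2 \<le> e"
    unfolding e_def using zero_le_power2[of "cir_a - 1"] a by (simp add: power2_eq_square algebra_simps)
  have num: "m\<^sub>1 x z * \<xi>\<^sub>2 x z * y - m\<^sub>2 x z * (\<xi>\<^sub>2 x z + y) + m\<^sub>3 x z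
      = x * z * (x + e * z + s * (cir_a - 1))"
    if "y = x + (cir_a + 3/4) * z + s" for y s
    unfolding that e_def m\<^sub>1_def m\<^sub>2_def m\<^sub>3_def \<xi>\<^sub>2_def
    by (simp add: power2_eq_square power3_eq_cube field_simps)
  have "r \<le> 2 * x + 2 * z"
  proof -
    have "(cir_a + 3/4)^2 \<le> 2^2"
      using a by (intro power_mono) auto
    then have "(cir_a + 3/4)^2 * z * z \<le> 4 * z * z"
      using z by (intro mult_right_mono) auto
    moreover have "cir_radicand x z = 3 * (x * z) + (cir_a + 3/4)^2 * z * z"
      by (simp add: cir_radicand_def distrib_right)
    moreover have "(2 * x + 2 * z)^2 = 4 * (x * x) + 8 * (x * z) + 4 * z * z"
      by (simp add: power2_eq_square algebra_simps)
    moreover have "0 < x * x" "0 < x * z"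
      using x z by auto
    ultimately have "cir_radicand x z \<le> (2 * x + 2 * z)^2"
      by linarith
    then show ?thesis
      unfolding r_def using x z by (intro real_le_lsqrt) (auto simp: cir_radicand_nonneg)
  qed
  then have "r * (cir_a - 1) \<le> (2 * x + 2 * z) * (1/5)"
    using a x z r by (intro mult_mono) auto
  moreover have "1/2 * z \<le> e * z"
    using e z by (intro mult_right_mono) auto
  moreover have "(2 * x + 2 * z) * (1/5) \<le> x + 1/2 * z"
    using x z by simp
  ultimately have "r * (cir_a - 1) \<le> x + e * z"
    by linarith
  then have small: "0 \<le> x + e * z + - r * (cir_a - 1)"
    by simp
  have "m\<^sub>1 x z * \<xi>\<^sub>2 x z * \<xi>\<^sub>3 x z - m\<^sub>2 x z * (\<xi>\<^sub>2 x z + \<xi>\<^sub>3 x z) + m\<^sub>3 x z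
      = x * z * (x + e * z + r * (cir_a - 1))"
    by (rule num) (simp add: \<xi>\<^sub>3_def r_def)
  moreover have "0 \<le> x * z * (x + e * z + r * (cir_a - 1))"
    using x z e r a by simp
  ultimately show "0 \<le> p\<^sub>1 x z"
    unfolding p\<^sub>1_def using o by simp
  have "m\<^sub>1 x z * \<xi>\<^sub>2 x z * \<xi>\<^sub>1 x z - m\<^sub>2 x z * (\<xi>\<^sub>2 x z + \<xi>\<^sub>1 x z) + m\<^sub>3 x z
      = x * z * (x + e * z + - r * (cir_a - 1))"
    by (rule num) (simp add: \<xi>\<^sub>1_def r_def)
  moreover have "0 \<le> x * z * (x + e * z + - r * (cir_a - 1))"
    using x z small by (intro mult_nonneg_nonneg) auto
  ultimately have "0 \<le> m\<^sub>1 x z * \<xi>\<^sub>1 x z * \<xi>\<^sub>2 x z - m\<^sub>2 x z * (\<xi>\<^sub>1 x z + \<xi>\<^sub>2 x z) + m\<^sub>3 x z"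
    by (simp add: ac_simps)
  then show "0 \<le> p\<^sub>3 x z"
    unfolding p\<^sub>3_def mult.assoc[of "\<xi>\<^sub>3 x z"] using o
    by (intro divide_nonneg_nonneg mult_nonneg_nonneg[of "\<xi>\<^sub>3 x z"] mult_nonpos_nonpos) auto
  have "m\<^sub>1 x z * (\<xi>\<^sub>1 x z * \<xi>\<^sub>3 x z) - m\<^sub>2 x z * (\<xi>\<^sub>1 x z + \<xi>\<^sub>3 x z) + m\<^sub>3 x z
      = - (x * z * (2 * x + 2 * cir_a * z))"
    unfolding cir_points_sym[OF assms] m\<^sub>1_def m\<^sub>2_def m\<^sub>3_def
    by (simp add: power2_eq_square power3_eq_cube field_simps)
  also have "\<dots> \<le> 0"
    using x z a by simp
  finally have "m\<^sub>1 x z * \<xi>\<^sub>1 x z * \<xi>\<^sub>3 x z - m\<^sub>2 x z * (\<xi>\<^sub>1 x z + \<xi>\<^sub>3 x z) + m\<^sub>3 x z \<le> 0"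
    by (simp add: mult.assoc)
  then show "0 \<le> p\<^sub>2 x z"
    unfolding p\<^sub>2_def using o by (intro divide_nonpos_nonpos mult_nonneg_nonpos) auto
qed

text \<open>
  The support of the law is known only once the three weights are shown to form a probability
  distribution; otherwise the law would be an unspecified one.
\<close>

lemma cir_law_nonneg:
  assumes x: "0 \<le> x" and z: "0 \<le> z" and Y: "Y \<in> set_pmf (cir_law x z)"
  shows "0 \<le> Y"
proof (cases "x = 0 \<or> z = 0")
  case True
  then show ?thesis using Y x by (simp add: cir_law_def)
next
  case False
  with x z have pos: "0 < x" "0 < z" by auto
  have "pmf_of_list_wf [(\<xi>\<^sub>1 x z, p\<^sub>1 x z), (\<xi>\<^sub>2 x z, p\<^sub>2 x z), (\<xi>\<^sub>3 x z, p\<^sub>3 x z)]"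
    using cir_weights_nonneg[OF pos] cir_weights_sum[OF pos]
    by (intro pmf_of_list_wfI) auto
  from set_pmf_of_list[OF this] have "Y \<in> {\<xi>\<^sub>1 x z, \<xi>\<^sub>2 x z, \<xi>\<^sub>3 x z}"
    using Y False by (auto simp: cir_law_def)
  then show ?thesis
    using cir_points_order[OF pos] by auto
qed

section \<open>The diffusion step and the splitting scheme\<close>

text \<open>
  Because \<open>Q\<close> maps the all-ones vector to \<open>(w \<bullet> 1) e\<^sub>N\<close>, the step leaves all coordinates of
  \<open>Q y\<close> except the last unchanged, and the last one, which was \<open>w \<bullet> y\<close>, becomes the sampled value.
\<close>

lemma diffusion_step_in_inv_cone:
  fixes w y :: "real ^ 'n::{finite,linorder}"
  assumes adm: "admissible x w Q" and w1: "0 < w \<bullet> 1"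
    and y: "y \<in> inv_cone Q" and h: "0 \<le> h" and s: "s \<in> set_pmf (diffusion_step w \<nu> y h)"
  shows "s \<in> inv_cone Q"
proof -
  have inv: "invertible Q" and Q1: "Q *v 1 = (w \<bullet> 1) *\<^sub>R e_last"
    using adm by (auto simp: admissible_def)
  have Qy: "\<And>i. 0 \<le> (Q *v y) $ i"
    using y by (simp add: inv_cone_iff[OF inv])
  obtain Y where Y: "Y \<in> set_pmf (cir_law (w \<bullet> y) (cir_z w \<nu> h))"
    and s: "s = y + ((Y - w \<bullet> y) / (w \<bullet> 1)) *\<^sub>R 1"
    using s by (auto simp: diffusion_step_def)
  have "0 \<le> Y"
    using Y by (rule cir_law_nonneg[rotated 2]) (simp_all add: admissible_inner[OF adm] Qy cir_z_def h)
  have "Q *v s = Q *v y + (Y - (Q *v y) $ Max UNIV) *\<^sub>R e_last"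
    using w1 by (simp add: s matrix_vector_right_distrib matrix_vector_mult_scaleR Q1 admissible_inner[OF adm, of y])
  then have "(Q *v s) $ i = (if i = Max UNIV then Y else (Q *v y) $ i)" for i
    by (simp add: e_last_def axis_def)
  with \<open>0 \<le> Y\<close> Qy show ?thesis
    by (simp add: inv_cone_iff[OF inv])
qed

theorem theorem3p1:
  fixes x w v0 :: "real ^ 'n::{finite,linorder}"
    and Q :: "real ^ 'n::{finite,linorder} ^ 'n::{finite,linorder}"
    and \<theta> lam \<nu> \<mu> :: real
  assumes "0 < x $ Min UNIV"
    and "\<forall>i j. i \<le> j \<longrightarrow> x $ i \<le> x $ j"
    and "\<forall>i. 0 < w $ i"
    and "0 \<le> \<theta>"
    and "admissible x w Q"
    and "0 \<le> \<mu>"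
    and "v0 = \<mu> *\<^sub>R (matrix_inv (diag x) *v 1)"
  shows "\<forall>v\<in>inv_cone Q. \<forall>h\<ge>0.
           (AE u in measure_pmf (A_CIR x w v0 \<theta> lam \<nu> v h). u \<in> inv_cone Q) \<and>
           0 \<le> A_CIR_radicand x w v0 \<theta> lam \<nu> v h"
proof (intro ballI allI impI)
  fix v h assume v: "v \<in> inv_cone Q" and h: "(0::real) \<le> h"
  have "x $ i \<noteq> 0" for i
  proof -
    have "x $ Min UNIV \<le> x $ i"
      using assms(2) by simp
    then show ?thesis using assms(1) by linarith
  qed
  then have v0: "diag x *v v0 = \<mu> *\<^sub>R 1"
    by (simp add: assms(7) matrix_vector_mult_scaleR diag_mult_matrix_inv)
  have w1: "0 < w \<bullet> 1"
    using assms(3) by (auto simp: inner_vec_def intro!: sum_pos)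
  have inv: "invertible Q"
    using assms(5) by (simp add: admissible_def)
  have drift: "drift_step x w v0 \<theta> lam z (h/2) \<in> inv_cone Q" if "z \<in> inv_cone Q" for z
    using that assms w1 v0 h by (intro drift_step_in_inv_cone[where \<mu> = \<mu>]) auto
  define y where "y = drift_step x w v0 \<theta> lam v (h/2)"
  have y: "y \<in> inv_cone Q"
    unfolding y_def by (rule drift[OF v])
  have "u \<in> inv_cone Q" if "u \<in> set_pmf (A_CIR x w v0 \<theta> lam \<nu> v h)" for u
    using that drift diffusion_step_in_inv_cone[OF assms(5) w1 y h]
    by (auto simp: A_CIR_def y_def)
  moreover have "0 \<le> A_CIR_radicand x w v0 \<theta> lam \<nu> v h"
    unfolding A_CIR_radicand_def y_def[symmetric]
    using y h by (intro cir_radicand_nonneg) (auto simp: admissible_inner[OF assms(5)] inv_cone_iff[OF inv] cir_z_def)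
  ultimately show "(AE u in measure_pmf (A_CIR x w v0 \<theta> lam \<nu> v h). u \<in> inv_cone Q) \<and>
      0 \<le> A_CIR_radicand x w v0 \<theta> lam \<nu> v h"
    by (simp add: AE_measure_pmf_iff)
qed

end
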